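(* Let $X(t)$, $t\ge 0$, be an inhomogeneous continuous-time Markov chain on $\{0,1,\dots,S\}$ with locally integrable transition intensities, and let $B(t)=(a_{ij}(t)-a_{i0}(t))_{i,j=1}^{S}$ be its reduced matrix. Suppose there exists an $S\times S$ matrix $D$ with nonnegative entries such that (i) there is $d>0$ with $\|\mathbf z\|_{1D}:=\|D\mathbf z\|\ge d\,\|\mathbf z\|$ for all $\mathbf z\in\mathbb R^S$ (in particular $D$ is invertible); (ii) $H(t)=(h_{ij}(t))_{i,j=1}^S:=DB(t)D^{-1}$ is essentially nonnegative for every $t\ge 0$. Put $$h^*(t)=\max_{1\le j\le S}\sum_{i=1}^S h_{ij}(t),\qquad h_*(t)=\min_{1\le j\le S}\sum_{i=1}^S h_{ij}(t).$$ Then for any two initial probability distributions $\mathbf p^{*}(0),\mathbf p^{**}(0)$ and all $t\ge 0$, $$\|\mathbf z^{*}(t)-\mathbf z^{**}(t)\|_{1D}\le e^{\int_0^t h^*(\tau)\,d\tau}\,\|\mathbf z^{*}(0)-\mathbf z^{**}(0)\|_{1D}.$$ Moreover, if the initial conditions are such that $D(\mathbf z^{*}(0)-\mathbf z^{**}(0))\ge \mathbf 0$ (coordinatewise), then for all $t\ge 0$, $$\|\mathbf z^{*}(t)-\mathbf z^{**}(t)\|_{1D}\ge e^{\int_0^t h_*(\tau)\,d\tau}\,\|\mathbf z^{*}(0)-\mathbf z^{**}(0)\|_{1D}.$$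
   Context: Setting. $X(t)$ is a continuous-time Markov chain on the finite state space $\{0,1,\dots,S\}$, with nonnegative transition intensities $q_{ij}(t)$ (from state $i$ to state $j\ne i$), which are locally integrable functions on $[0,\infty)$. Set $a_{ij}(t)=q_{ji}(t)$ for $j\ne i$ and $a_{ii}(t)=-\sum_{j\ne i}q_{ij}(t)$; $A(t)=(a_{ij}(t))_{i,j=0}^S$ is the transposed intensity matrix. The vector of state probabilities $\mathbf p(t)=(p_0(t),\dots,p_S(t))^T$, $p_i(t)=\Pr\{X(t)=i\}$, is the solution of the forward Kolmogorov system $\frac{d\mathbf p}{dt}=A(t)\mathbf p(t)$ (understood as a locally absolutely continuous function satisfying the equation for almost all $t$); if $\mathbf p(0)$ is a probability vector then so is $\mathbf p(t)$ for every $t\ge0$. Reduced vector. $\mathbf z(t)=(p_1(t),\dots,p_S(t))^T$; using $p_0=1-\sum_{i\ge1}p_i$ it satisfies $\frac{d\mathbf z}{dt}=B(t)\mathbf z+\mathbf f(t)$ with $\mathbf f(t)=(a_{10}(t),\dots,a_{S0}(t))^T$ and $B(t)=(a_{ij}(t)-a_{i0}(t))_{i,j=1}^S$. Given two initial probability vectors $\mathbf p^*(0),\mathbf p^{**}(0)$, the corresponding solutions are $\mathbf p^*(t),\mathbf p^{**}(t)$ and their reduced vectors are $\mathbf z^*(t),\mathbf z^{**}(t)$. Notation. $\|\mathbf x\|=\sum_i|x_i|$ is the $l_1$-norm. A square matrix is essentially nonnegative if all its off-diagonal entries are nonnegative. *)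

theory Defs
  imports "HOL-Analysis.Analysis"
begin

text \<open>
  The state space \<open>{0, 1, \<dots>, S}\<close> is the type \<open>'n option\<close> over a finite index type \<open>'n\<close> with
  \<open>S = CARD('n)\<close>: \<open>None\<close> is state 0 and \<open>Some i\<close>, with \<open>i :: 'n\<close>, are the states \<open>1, \<dots>, S\<close>.
  Intensities are written \<open>q i j t\<close> (from state \<open>i\<close> to state \<open>j\<close> at time \<open>t\<close>); the diagonal
  functions \<open>q i i\<close> are never used.
\<close>

definition l1_norm :: "real ^ 'm \<Rightarrow> real" where
  "l1_norm x = (\<Sum>i\<in>UNIV. \<bar>x $ i\<bar>)"

definition essentially_nonnegative :: "real ^ 'm ^ 'm \<Rightarrow> bool" where
  "essentially_nonnegative M \<longleftrightarrow> (\<forall>i j. i \<noteq> j \<longrightarrow> 0 \<le> M $ i $ j)"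

definition probability_vector :: "real ^ 'm \<Rightarrow> bool" where
  "probability_vector p \<longleftrightarrow> (\<forall>i. 0 \<le> p $ i) \<and> (\<Sum>i\<in>UNIV. p $ i) = 1"

definition locally_integrable :: "(real \<Rightarrow> real) \<Rightarrow> bool" where
  "locally_integrable f \<longleftrightarrow> (\<forall>T\<ge>0. f absolutely_integrable_on {0..T})"

text \<open>
  The epsilon-delta definition of absolute continuity of a function on \<open>{a..b}\<close>. The members of a
  division are nonempty compact intervals with pairwise disjoint interiors, so \<open>Inf k\<close> and
  \<open>Sup k\<close> are the endpoints of \<open>k\<close>. (The library's \<open>absolutely_continuous\<close> is about measures.)
\<close>

definition abs_continuous_on_interval ::
    "real \<Rightarrow> real \<Rightarrow> (real \<Rightarrow> 'a::real_normed_vector) \<Rightarrow> bool" where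
  "abs_continuous_on_interval a b f \<longleftrightarrow>
     (\<forall>\<epsilon>>0. \<exists>\<delta>>0. \<forall>\<D>. \<D> division_of \<Union>\<D> \<and> \<Union>\<D> \<subseteq> {a..b} \<and> (\<Sum>k\<in>\<D>. Sup k - Inf k) < \<delta> \<longrightarrow>
        (\<Sum>k\<in>\<D>. norm (f (Sup k) - f (Inf k))) < \<epsilon>)"

definition locally_abs_continuous :: "(real \<Rightarrow> 'a::real_normed_vector) \<Rightarrow> bool" where
  "locally_abs_continuous f \<longleftrightarrow> (\<forall>T\<ge>0. abs_continuous_on_interval 0 T f)"

definition transition_intensities :: "('s \<Rightarrow> 's \<Rightarrow> real \<Rightarrow> real) \<Rightarrow> bool" where
  "transition_intensities q \<longleftrightarrow>
     (\<forall>i j. i \<noteq> j \<longrightarrow> (\<forall>t\<ge>0. 0 \<le> q i j t) \<and> locally_integrable (q i j))"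

definition transposed_intensity_matrix ::
    "('s::finite \<Rightarrow> 's \<Rightarrow> real \<Rightarrow> real) \<Rightarrow> real \<Rightarrow> real ^ 's ^ 's" where
  "transposed_intensity_matrix q t =
     (\<chi> i j. if i = j then - (\<Sum>k\<in>UNIV - {i}. q i k t) else q j i t)"

definition kolmogorov_solution ::
    "('s::finite \<Rightarrow> 's \<Rightarrow> real \<Rightarrow> real) \<Rightarrow> (real \<Rightarrow> real ^ 's) \<Rightarrow> bool" where
  "kolmogorov_solution q p \<longleftrightarrow>
     locally_abs_continuous p \<and>
     (AE t in lebesgue. t \<ge> 0 \<longrightarrow>
        (p has_vector_derivative transposed_intensity_matrix q t *v p t) (at t within {0..}))"

definition reduced_vector :: "real ^ ('n::finite option) \<Rightarrow> real ^ 'n" where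
  "reduced_vector p = (\<chi> i. p $ Some i)"

definition reduced_matrix ::
    "('n::finite option \<Rightarrow> 'n option \<Rightarrow> real \<Rightarrow> real) \<Rightarrow> real \<Rightarrow> real ^ 'n ^ 'n" where
  "reduced_matrix q t =
     (\<chi> i j. transposed_intensity_matrix q t $ Some i $ Some j
           - transposed_intensity_matrix q t $ Some i $ None)"

definition norm_1D :: "real ^ 'n ^ 'n \<Rightarrow> real ^ 'n \<Rightarrow> real" where
  "norm_1D D z = l1_norm (D *v z)"

definition transformed_matrix ::
    "real ^ 'n ^ 'n \<Rightarrow> ('n::finite option \<Rightarrow> 'n option \<Rightarrow> real \<Rightarrow> real) \<Rightarrow> real \<Rightarrow> real ^ 'n ^ 'n" where
  "transformed_matrix D q t = D ** reduced_matrix q t ** matrix_inv D"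

definition max_column_sum :: "real ^ 'n ^ 'n \<Rightarrow> real" where
  "max_column_sum M = Max (range (\<lambda>j. \<Sum>i\<in>UNIV. M $ i $ j))"

definition min_column_sum :: "real ^ 'n ^ 'n \<Rightarrow> real" where
  "min_column_sum M = Min (range (\<lambda>j. \<Sum>i\<in>UNIV. M $ i $ j))"

end

theory Submission
  imports Defs
begin

text \<open>
  The probabilities of each solution sum to 1, so the difference of the two reduced vectors solves
  \<open>y' = B y\<close> and \<open>w = D y\<close> solves \<open>w' = H w\<close>. As \<open>H\<close> is essentially
  nonnegative, the one-sided derivatives of \<open>\<bar>w\<^sub>i\<bar>\<close> are almost everywhere at most
  \<open>\<Sum>\<^sub>j h\<^sub>i\<^sub>j \<bar>w\<^sub>j\<bar>\<close>; summing over \<open>i\<close> gives \<open>U' \<le> h\<^sup>* U\<close> both for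
  \<open>U = \<parallel>w\<parallel>\<close> and for \<open>U = \<parallel>w\<parallel> - \<Sum>\<^sub>i w\<^sub>i\<close>. Gronwall's
  inequality turns the first into the upper bound and the second into the invariance of the
  nonnegative orthant, in which \<open>\<parallel>w\<parallel> = \<Sum>\<^sub>i w\<^sub>i\<close> grows at rate at least
  \<open>h\<^sub>*\<close>.
\<close>

section \<open>Functions with small variation on null sets\<close>

text \<open>
  This condition stands in for absolute continuity: it follows from the epsilon-delta definition
  on divisions, but holds for indefinite integrals directly by Henstock's lemma and is just what
  a Cousin-type argument needs in order to ignore a null set of tags.
\<close>

definition strong_lusin_on :: "real \<Rightarrow> real \<Rightarrow> (real \<Rightarrow> 'a::real_normed_vector) \<Rightarrow> bool" where
  "strong_lusin_on a b f \<longleftrightarrow>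
     (\<forall>N e. negligible N \<and> 0 < e \<longrightarrow>
        (\<exists>\<gamma>. gauge \<gamma> \<and>
           (\<forall>p. p tagged_partial_division_of {a..b} \<and> \<gamma> fine p \<and> fst ` p \<subseteq> N \<longrightarrow>
              (\<Sum>(x, K)\<in>p. norm (f (Sup K) - f (Inf K))) < e)))"

lemma strong_lusin_onE:
  assumes "strong_lusin_on a b f" "negligible N" "0 < e"
  obtains \<gamma> where "gauge \<gamma>"
    "\<And>p. p tagged_partial_division_of {a..b} \<Longrightarrow> \<gamma> fine p \<Longrightarrow> fst ` p \<subseteq> N \<Longrightarrow>
       (\<Sum>(x, K)\<in>p. norm (f (Sup K) - f (Inf K))) < e"
proof -
  from assms obtain \<gamma> where "gauge \<gamma> \<and> (\<forall>p. p tagged_partial_division_of {a..b} \<and> \<gamma> fine p \<and> fst ` p \<subseteq> N \<longrightarrow>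
      (\<Sum>(x, K)\<in>p. norm (f (Sup K) - f (Inf K))) < e)"
    unfolding strong_lusin_on_def by iprover
  then show thesis by (intro that[of \<gamma>]) simp_all
qed

lemma tagged_partial_division_interval:
  fixes a b :: real
  assumes "p tagged_partial_division_of {a..b}" "(x, K) \<in> p"
  obtains u v where "K = {u..v}" "u \<le> x" "x \<le> v" "a \<le> u" "v \<le> b" "Inf K = u" "Sup K = v"
proof -
  obtain u v where "K = cbox u v" using tagged_partial_division_ofD(4)[OF assms] by blast
  moreover have "x \<in> K" "K \<subseteq> {a..b}" using tagged_partial_division_ofD[OF assms(1)] assms(2) by blast+
  ultimately show thesis using that[of u v] by auto
qed

text \<open>By outer regularity a null set lies in an open set of measure below \<delta>. A gauge
  that confines every interval tagged in \<open>N\<close> to this open set makes the total length of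
  these intervals smaller than \<delta>.\<close>

lemma abs_continuous_imp_strong_lusin:
  assumes "abs_continuous_on_interval a b f"
  shows "strong_lusin_on a b f"
  unfolding strong_lusin_on_def
proof (intro allI impI, elim conjE)
  fix N :: "real set" and e :: real
  assume N: "negligible N" and "0 < e"
  then obtain \<delta> where "\<delta> > 0" and \<delta>: "\<And>\<D>. \<D> division_of \<Union>\<D> \<Longrightarrow> \<Union>\<D> \<subseteq> {a..b} \<Longrightarrow>
      (\<Sum>k\<in>\<D>. Sup k - Inf k) < \<delta> \<Longrightarrow> (\<Sum>k\<in>\<D>. norm (f (Sup k) - f (Inf k))) < e"
    using assms unfolding abs_continuous_on_interval_def by meson
  have Nnull: "N \<in> null_sets lebesgue" using N by (simp add: negligible_iff_null_sets)
  obtain T where T: "open T" "N \<subseteq> T" "T - N \<in> lmeasurable" "emeasure lebesgue (T - N) < ennreal \<delta>"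
    using sets_lebesgue_outer_open[of N \<delta>] Nnull \<open>\<delta> > 0\<close> by auto
  have TL: "T \<in> sets lebesgue" using T(1) by auto
  have "emeasure lebesgue (T - N) = emeasure lebesgue T"
    by (rule emeasure_Diff_null_set[OF Nnull TL])
  then have emT: "emeasure lebesgue T < ennreal \<delta>" using T(4) by simp
  then have Tm: "T \<in> lmeasurable"
    using TL by (intro fmeasurableI) (auto intro: order_less_trans[OF _ ennreal_less_top])
  have mT: "measure lebesgue T < \<delta>"
    using emT Tm \<open>\<delta> > 0\<close> by (simp add: emeasure_eq_measure2 ennreal_less_iff)
  define \<gamma> where "\<gamma> = (\<lambda>x. if x \<in> T then T else UNIV)"
  have "gauge \<gamma>" unfolding \<gamma>_def gauge_def using T(1) by auto
  moreover have "(\<Sum>(x, K)\<in>p. norm (f (Sup K) - f (Inf K))) < e"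
    if p: "p tagged_partial_division_of {a..b}" and fine: "\<gamma> fine p" and tags: "fst ` p \<subseteq> N" for p
  proof -
    define \<D> where "\<D> = snd ` p"
    have div: "\<D> division_of \<Union>\<D>"
      unfolding \<D>_def by (rule partial_division_of_tagged_division[OF p])
    have int: "\<exists>u v. K = {u..v} \<and> u \<le> v \<and> a \<le> u \<and> v \<le> b \<and> K \<subseteq> T" if K: "K \<in> \<D>" for K
    proof -
      obtain x where x: "(x, K) \<in> p" using K unfolding \<D>_def by auto
      then have "x \<in> T" using tags T(2) by force
      then have "K \<subseteq> T" using fine x unfolding fine_def \<gamma>_def by force
      then show ?thesis using tagged_partial_division_interval[OF p x] by (metis order_trans)
    qed
    have "(\<Sum>k\<in>\<D>. Sup k - Inf k) = (\<Sum>k\<in>\<D>. measure lebesgue k)"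
      by (rule sum.cong) (use int in force)+
    also have "\<dots> = measure lebesgue (\<Union>\<D>)" by (rule content_division[OF div])
    also have "\<dots> \<le> measure lebesgue T"
    proof (rule measure_mono_fmeasurable)
      show "\<Union>\<D> \<subseteq> T" using int by blast
      show "\<Union>\<D> \<in> sets lebesgue" using lmeasurable_division[OF div] by auto
    qed (rule Tm)
    finally have "(\<Sum>k\<in>\<D>. Sup k - Inf k) < \<delta>" using mT by simp
    moreover have "\<Union>\<D> \<subseteq> {a..b}"
      using tagged_partial_division_ofD(3)[OF p] unfolding \<D>_def by force
    ultimately have less: "(\<Sum>k\<in>\<D>. norm (f (Sup k) - f (Inf k))) < e"
      using \<delta> div by blast
    \<comment> \<open>Passing from a sum over tagged intervals to a sum over intervals requires a
      summand that vanishes on every box with empty interior. This includes the empty box, where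
      \<open>Inf\<close> and \<open>Sup\<close> say nothing.\<close>
    define d where "d K = (if K = {} then 0 else norm (f (Sup K) - f (Inf K)))" for K
    have "(\<Sum>(x, K)\<in>p. norm (f (Sup K) - f (Inf K))) = (\<Sum>(x, K)\<in>p. d K)"
      by (intro sum.cong) (use tagged_partial_division_ofD(2)[OF p] in \<open>fastforce simp: d_def\<close>)+
    also have "\<dots> = sum d \<D>"
      unfolding \<D>_def
    proof (rule sum.over_tagged_division_lemma[OF tagged_partial_division_of_Union_self[OF p]])
      fix u v :: real assume "box u v = {}"
      then have "v \<le> u" by simp
      then show "d (cbox u v) = 0" by (cases "u = v") (auto simp: d_def)
    qed
    also have "\<dots> = (\<Sum>k\<in>\<D>. norm (f (Sup k) - f (Inf k)))"
      by (rule sum.cong) (use int in \<open>force simp: d_def\<close>)+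
    finally show ?thesis using less by simp
  qed
  ultimately show "\<exists>\<gamma>. gauge \<gamma> \<and> (\<forall>p. p tagged_partial_division_of {a..b} \<and> \<gamma> fine p \<and> fst ` p \<subseteq> N \<longrightarrow>
          (\<Sum>(x, K)\<in>p. norm (f (Sup K) - f (Inf K))) < e)"
    by (intro exI[of _ \<gamma>] conjI allI impI) simp_all
qed

text \<open>Setting the integrand to 0 on \<open>N\<close> changes no integral but removes every
  Riemann term with tag in \<open>N\<close>. Henstock's lemma then bounds the sum of the norms of
  the increments themselves.\<close>

lemma indefinite_integral_strong_lusin:
  fixes h :: "real \<Rightarrow> 'a::euclidean_space"
  assumes h: "h integrable_on {a..b}"
  shows "strong_lusin_on a b (\<lambda>t. integral {a..t} h)"
  unfolding strong_lusin_on_def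
proof (intro allI impI, elim conjE)
  fix N :: "real set" and e :: real
  assume N: "negligible N" and "0 < e"
  define g where "g x = (if x \<in> N then 0 else h x)" for x
  have gi: "g integrable_on {a..b}"
    by (rule integrable_spike[OF h N]) (auto simp: g_def)
  have geq: "integral S g = integral S h" for S
    by (rule integral_spike[OF N]) (auto simp: g_def)
  obtain \<gamma> where \<gamma>: "gauge \<gamma>"
    "\<And>p. \<lbrakk>p tagged_partial_division_of (cbox a b); \<gamma> fine p\<rbrakk> \<Longrightarrow>
             sum (\<lambda>(x,k). norm(measure lborel k *\<^sub>R g x - integral k g)) p < e"
    using Henstock_lemma[of g a b e] gi \<open>0 < e\<close> by auto
  have "(\<Sum>(x, K)\<in>p. norm (integral {a..Sup K} h - integral {a..Inf K} h)) < e"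
    if p: "p tagged_partial_division_of {a..b}" and fine: "\<gamma> fine p" and tags: "fst ` p \<subseteq> N" for p
  proof -
    have "(\<Sum>(x, K)\<in>p. norm (integral {a..Sup K} h - integral {a..Inf K} h))
        = (\<Sum>(x, K)\<in>p. norm (measure lborel K *\<^sub>R g x - integral K g))"
    proof (rule sum.cong[OF refl], clarify)
      fix x K assume xK: "(x, K) \<in> p"
      obtain u v where K: "K = {u..v}" "u \<le> x" "x \<le> v" "a \<le> u" "v \<le> b" "Inf K = u" "Sup K = v"
        using tagged_partial_division_interval[OF p xK] .
      have "g x = 0" using xK tags by (force simp: g_def)
      moreover have "integral {a..u} h + integral {u..v} h = integral {a..v} h"
        by (rule Henstock_Kurzweil_Integration.integral_combine)
          (use K integrable_on_subinterval[OF h] in auto)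
      ultimately show "norm (integral {a..Sup K} h - integral {a..Inf K} h) =
          norm (measure lborel K *\<^sub>R g x - integral K g)"
        using K(6,7) K(1) by (simp add: geq) (metis add_diff_cancel_left')
    qed
    then show ?thesis using \<gamma>(2)[of p] p fine by simp
  qed
  then show "\<exists>\<gamma>. gauge \<gamma> \<and> (\<forall>p. p tagged_partial_division_of {a..b} \<and> \<gamma> fine p \<and> fst ` p \<subseteq> N \<longrightarrow>
          (\<Sum>(x, K)\<in>p. norm (integral {a..Sup K} h - integral {a..Inf K} h)) < e)"
    using \<gamma>(1) by (intro exI[of _ \<gamma>] conjI allI impI) simp_all
qed

section \<open>Closure properties\<close>

text \<open>The intersection of the gauges of \<open>f\<close> and \<open>g\<close> serves both at
  once. Two dominating functions cover products and differences; unary operations supply the same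
  function twice.\<close>

lemma strong_lusin_on_dominated:
  assumes f: "strong_lusin_on a b f" and g: "strong_lusin_on a b g"
    and le: "\<And>u v. a \<le> u \<Longrightarrow> u \<le> v \<Longrightarrow> v \<le> b \<Longrightarrow>
       norm (k v - k u) \<le> C * (norm (f v - f u) + norm (g v - g u))"
  shows "strong_lusin_on a b k"
  unfolding strong_lusin_on_def
proof (intro allI impI, elim conjE)
  fix N :: "real set" and e :: real
  assume N: "negligible N" and "0 < e"
  \<comment> \<open>\<open>C\<close> may be zero or negative; \<open>c\<close> is a positive upper
    bound, by which \<open>e\<close> can be divided.\<close>
  define c where "c = \<bar>C\<bar> + 1"
  have c: "c > 0" "C \<le> c" by (auto simp: c_def)
  obtain \<gamma>1 where \<gamma>1: "gauge \<gamma>1" "\<And>p. p tagged_partial_division_of {a..b} \<Longrightarrow> \<gamma>1 fine p \<Longrightarrow>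
     fst ` p \<subseteq> N \<Longrightarrow> (\<Sum>(x, K)\<in>p. norm (f (Sup K) - f (Inf K))) < e / (2 * c)"
    by (rule strong_lusin_onE[OF f N, of "e / (2 * c)"]) (use c \<open>0 < e\<close> in auto)
  obtain \<gamma>2 where \<gamma>2: "gauge \<gamma>2" "\<And>p. p tagged_partial_division_of {a..b} \<Longrightarrow> \<gamma>2 fine p \<Longrightarrow>
     fst ` p \<subseteq> N \<Longrightarrow> (\<Sum>(x, K)\<in>p. norm (g (Sup K) - g (Inf K))) < e / (2 * c)"
    by (rule strong_lusin_onE[OF g N, of "e / (2 * c)"]) (use c \<open>0 < e\<close> in auto)
  have "(\<Sum>(x, K)\<in>p. norm (k (Sup K) - k (Inf K))) < e"
    if p: "p tagged_partial_division_of {a..b}" and fine: "(\<lambda>x. \<gamma>1 x \<inter> \<gamma>2 x) fine p"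
      and tags: "fst ` p \<subseteq> N" for p
  proof -
    have "(\<Sum>(x, K)\<in>p. norm (k (Sup K) - k (Inf K)))
      \<le> (\<Sum>(x, K)\<in>p. c * (norm (f (Sup K) - f (Inf K)) + norm (g (Sup K) - g (Inf K))))"
    proof (rule sum_mono, clarify)
      fix x K assume "(x, K) \<in> p"
      then obtain u v where K: "a \<le> u" "u \<le> v" "v \<le> b" "Inf K = u" "Sup K = v"
        using tagged_partial_division_interval[OF p] by (metis order_trans)
      have "norm (k v - k u) \<le> C * (norm (f v - f u) + norm (g v - g u))" by (rule le) (use K in auto)
      also have "\<dots> \<le> c * (norm (f v - f u) + norm (g v - g u))"
        by (rule mult_right_mono) (use c in auto)
      finally show "norm (k (Sup K) - k (Inf K))
         \<le> c * (norm (f (Sup K) - f (Inf K)) + norm (g (Sup K) - g (Inf K)))"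
        using K by simp
    qed
    also have "\<dots> = c * ((\<Sum>(x, K)\<in>p. norm (f (Sup K) - f (Inf K))) + (\<Sum>(x, K)\<in>p. norm (g (Sup K) - g (Inf K))))"
      by (simp add: case_prod_unfold sum.distrib flip: sum_distrib_left)
    also have "\<dots> < c * (e / (2 * c) + e / (2 * c))"
      using \<gamma>1(2)[OF p _ tags] \<gamma>2(2)[OF p _ tags] fine c(1)
      by (intro mult_strict_left_mono add_strict_mono) (auto simp: fine_Int)
    also have "\<dots> = e" using c(1) by (simp add: field_simps)
    finally show ?thesis .
  qed
  then show "\<exists>\<gamma>. gauge \<gamma> \<and> (\<forall>p. p tagged_partial_division_of {a..b} \<and> \<gamma> fine p \<and> fst ` p \<subseteq> N \<longrightarrow>
          (\<Sum>(x, K)\<in>p. norm (k (Sup K) - k (Inf K))) < e)"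
    using gauge_Int[OF \<gamma>1(1) \<gamma>2(1)]
    by (intro exI[of _ "\<lambda>x. \<gamma>1 x \<inter> \<gamma>2 x"] conjI allI impI) simp_all
qed

text \<open>A singleton \<open>{x}\<close> is negligible, so the condition, applied to one interval
  with tag and endpoint \<open>x\<close>, yields continuity at \<open>x\<close>. Compactness of
  \<open>{a..b}\<close> does the rest.\<close>

lemma strong_lusin_imp_bounded:
  assumes f: "strong_lusin_on a b f"
  shows "\<exists>B\<ge>0. \<forall>t\<in>{a..b}. norm (f t) \<le> B"
proof -
  have "continuous_on {a..b} f"
    unfolding continuous_on_iff
  proof (intro ballI allI impI)
    fix x and e :: real
    assume x: "x \<in> {a..b}" and "0 < e"
    obtain \<gamma> where \<gamma>: "gauge \<gamma>" "\<And>p. p tagged_partial_division_of {a..b} \<Longrightarrow> \<gamma> fine p \<Longrightarrow>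
       fst ` p \<subseteq> {x} \<Longrightarrow> (\<Sum>(x, K)\<in>p. norm (f (Sup K) - f (Inf K))) < e"
      by (rule strong_lusin_onE[OF f, of "{x}" e]) (use \<open>0 < e\<close> in auto)
    obtain d where d: "d > 0" "ball x d \<subseteq> \<gamma> x"
      using gaugeD[OF \<gamma>(1), of x] openE by blast
    have "dist (f y) (f x) < e" if y: "y \<in> {a..b}" "dist y x < d" for y
    proof -
      define u v where "u = min x y" and "v = max x y"
      have "{(x, {u..v})} tagged_partial_division_of {a..b}"
        unfolding tagged_partial_division_of_def using x y by (auto simp: u_def v_def)
      moreover have "\<gamma> fine {(x, {u..v})}"
        using d y by (force simp: fine_def u_def v_def dist_real_def)
      ultimately have "norm (f v - f u) < e"
        using \<gamma>(2)[of "{(x, {u..v})}"] by (simp add: u_def v_def)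
      then show ?thesis
        by (cases "x \<le> y") (auto simp: u_def v_def dist_norm norm_minus_commute)
    qed
    then show "\<exists>d>0. \<forall>x'\<in>{a..b}. dist x' x < d \<longrightarrow> dist (f x') (f x) < e" using d(1) by blast
  qed
  then have "bounded (f ` {a..b})"
    by (intro compact_imp_bounded compact_continuous_image) auto
  then show ?thesis
    unfolding bounded_pos by (meson imageI less_imp_le)
qed

text \<open>Both factors are bounded, so the product rule for increments dominates the increment of
  the product by those of the factors.\<close>

lemma strong_lusin_on_mult:
  fixes f g :: "real \<Rightarrow> real"
  assumes f: "strong_lusin_on a b f" and g: "strong_lusin_on a b g"
  shows "strong_lusin_on a b (\<lambda>t. f t * g t)"
proof -
  obtain B where B: "B \<ge> 0" "\<And>t. t \<in> {a..b} \<Longrightarrow> norm (f t) \<le> B"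
    using strong_lusin_imp_bounded[OF f] by blast
  obtain C where C: "C \<ge> 0" "\<And>t. t \<in> {a..b} \<Longrightarrow> norm (g t) \<le> C"
    using strong_lusin_imp_bounded[OF g] by blast
  show ?thesis
  proof (rule strong_lusin_on_dominated[OF f g, of _ "B + C"])
    fix u v assume uv: "a \<le> u" "u \<le> v" "v \<le> b"
    have "f v * g v - f u * g u = (f v - f u) * g v + f u * (g v - g u)" by (simp add: algebra_simps)
    then have "norm (f v * g v - f u * g u) \<le> norm (f v - f u) * norm (g v) + norm (f u) * norm (g v - g u)"
      by (metis norm_mult norm_triangle_ineq)
    also have "\<dots> \<le> norm (f v - f u) * (B + C) + (B + C) * norm (g v - g u)"
      using B(1) C(1) B(2)[of u] C(2)[of v] uv by (intro add_mono mult_mono) auto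
    finally show "norm (f v * g v - f u * g u) \<le> (B + C) * (norm (f v - f u) + norm (g v - g u))"
      by (simp add: algebra_simps)
  qed
qed

text \<open>Since \<open>f\<close> is bounded by some \<open>B\<close>, only the Lipschitz constant
  \<open>exp B\<close> of the exponential on arguments up to \<open>B\<close> matters.\<close>

lemma strong_lusin_on_exp:
  fixes f :: "real \<Rightarrow> real"
  assumes f: "strong_lusin_on a b f"
  shows "strong_lusin_on a b (\<lambda>t. exp (f t))"
proof -
  obtain B where B: "B \<ge> 0" "\<And>t. t \<in> {a..b} \<Longrightarrow> norm (f t) \<le> B"
    using strong_lusin_imp_bounded[OF f] by blast
  have exp_diff: "\<bar>exp x - exp y\<bar> \<le> exp B * \<bar>x - y\<bar>" if "x \<le> B" "y \<le> B" for x y :: real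
  proof -
    have *: "exp x - exp y \<le> exp B * (x - y)" if "y \<le> x" "x \<le> B" for x y :: real
    proof -
      have "exp x - exp y = exp x * (1 - exp (y - x))" by (simp add: algebra_simps flip: exp_add)
      also have "\<dots> \<le> exp x * (x - y)"
      proof (rule mult_left_mono)
        show "1 - exp (y - x) \<le> x - y" using exp_ge_add_one_self[of "y - x"] by linarith
      qed simp
      also have "\<dots> \<le> exp B * (x - y)" using that by (intro mult_right_mono) auto
      finally show ?thesis .
    qed
    show ?thesis using *[of y x] *[of x y] that by (cases "y \<le> x") auto
  qed
  show ?thesis
  proof (rule strong_lusin_on_dominated[OF f f, of _ "exp B"])
    fix u v assume uv: "a \<le> u" "u \<le> v" "v \<le> b"
    have "norm (exp (f v) - exp (f u)) \<le> exp B * norm (f v - f u)"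
      using exp_diff[of "f v" "f u"] B(2)[of u] B(2)[of v] uv by auto
    also have "\<dots> \<le> exp B * (norm (f v - f u) + norm (f v - f u))" by (intro mult_left_mono) auto
    finally show "norm (exp (f v) - exp (f u)) \<le> exp B * (norm (f v - f u) + norm (f v - f u))" .
  qed
qed

section \<open>Monotonicity from one-sided derivatives\<close>

text \<open>Because \<open>t\<close> lies between \<open>u\<close> and \<open>v\<close>, the right
  derivative controls \<open>f v - f t\<close> and the left one controls \<open>f t - f u\<close>;
  the two derivatives need not agree.\<close>

lemma one_sided_derivatives_nonpos_increment:
  fixes f :: "real \<Rightarrow> real"
  assumes r: "(f has_real_derivative r) (at t within {t..})" "r \<le> 0"
    and l: "(f has_real_derivative l) (at t within {..t})" "l \<le> 0"
    and "e > 0"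
  shows "\<exists>d>0. \<forall>u v. u \<le> t \<and> t \<le> v \<and> {u..v} \<subseteq> ball t d \<longrightarrow> f v - f u \<le> e * (v - u)"
proof -
  obtain d1 where d1: "d1 > 0" "\<And>y. y \<ge> t \<Longrightarrow> norm (y - t) < d1 \<Longrightarrow>
      norm (f y - f t - r * (y - t)) \<le> e * norm (y - t)"
    using r(1) \<open>e > 0\<close> unfolding has_field_derivative_def has_derivative_within_alt by (metis atLeast_iff)
  obtain d2 where d2: "d2 > 0" "\<And>y. y \<le> t \<Longrightarrow> norm (y - t) < d2 \<Longrightarrow>
      norm (f y - f t - l * (y - t)) \<le> e * norm (y - t)"
    using l(1) \<open>e > 0\<close> unfolding has_field_derivative_def has_derivative_within_alt by (metis atMost_iff)
  have "f v - f u \<le> e * (v - u)" if uv: "u \<le> t" "t \<le> v" "{u..v} \<subseteq> ball t (min d1 d2)" for u v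
  proof -
    have mem: "u \<in> ball t (min d1 d2)" "v \<in> ball t (min d1 d2)" using uv(3) order_trans[OF uv(1,2)] by (auto simp: subset_iff simp del: mem_ball)
    have "f v - f t - r * (v - t) \<le> e * (v - t)"
      using d1(2)[of v] uv mem by (auto simp: dist_real_def)
    moreover have "- (f u - f t - l * (u - t)) \<le> e * (t - u)"
      using d2(2)[of u] uv mem by (auto simp: dist_real_def)
    moreover have "r * (v - t) \<le> 0" "l * (t - u) \<le> 0"
      using uv r(2) l(2) by (auto simp: mult_nonpos_nonneg)
    ultimately show ?thesis by (simp add: algebra_simps)
  qed
  then show ?thesis using d1(1) d2(1) by (intro exI[of _ "min d1 d2"]) auto
qed

text \<open>Cousin's lemma supplies a fine tagged division. The intervals tagged in the exceptional
  null set contribute at most \<open>e\<close> altogether, and each other interval at most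
  \<open>e\<close> times its length.\<close>

lemma strong_lusin_nonincreasing:
  fixes f :: "real \<Rightarrow> real"
  assumes f: "strong_lusin_on a b f" and N: "negligible N" and "a \<le> b"
    and deriv: "\<And>t. t \<in> {a<..<b} - N \<Longrightarrow>
       \<exists>r l. (f has_real_derivative r) (at t within {t..}) \<and> r \<le> 0 \<and>
             (f has_real_derivative l) (at t within {..t}) \<and> l \<le> 0"
  shows "f b \<le> f a"
proof (rule field_le_epsilon)
  fix e0 :: real assume "e0 > 0"
  \<comment> \<open>Chosen so that the final bound \<open>e * (1 + (b - a))\<close> equals
    \<open>e0\<close>.\<close>
  define e where "e = e0 / (1 + (b - a))"
  have "e > 0" using \<open>e0 > 0\<close> \<open>a \<le> b\<close> by (simp add: e_def)
  \<comment> \<open>The derivative bounds are available only in the open interval, so the endpoints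
    join the exceptional set.\<close>
  define M where "M = N \<union> {a, b}"
  have M: "negligible M" using N by (simp add: M_def negligible_Un)
  obtain \<gamma> where \<gamma>: "gauge \<gamma>" "\<And>p. p tagged_partial_division_of {a..b} \<Longrightarrow> \<gamma> fine p \<Longrightarrow>
     fst ` p \<subseteq> M \<Longrightarrow> (\<Sum>(x, K)\<in>p. norm (f (Sup K) - f (Inf K))) < e"
    by (rule strong_lusin_onE[OF f M \<open>e > 0\<close>]) blast
  have "\<forall>t\<in>{a..b} - M. \<exists>d>0. \<forall>u v. u \<le> t \<and> t \<le> v \<and> {u..v} \<subseteq> ball t d \<longrightarrow> f v - f u \<le> e * (v - u)"
  proof
    fix t assume "t \<in> {a..b} - M"
    then have "t \<in> {a<..<b} - N" by (auto simp: M_def)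
    then show "\<exists>d>0. \<forall>u v. u \<le> t \<and> t \<le> v \<and> {u..v} \<subseteq> ball t d \<longrightarrow> f v - f u \<le> e * (v - u)"
      using deriv one_sided_derivatives_nonpos_increment \<open>e > 0\<close> by meson
  qed
  then obtain \<delta> where \<delta>: "\<And>t. t \<in> {a..b} - M \<Longrightarrow> \<delta> t > 0"
    "\<And>t u v. t \<in> {a..b} - M \<Longrightarrow> u \<le> t \<Longrightarrow> t \<le> v \<Longrightarrow> {u..v} \<subseteq> ball t (\<delta> t) \<Longrightarrow> f v - f u \<le> e * (v - u)"
    by metis
  \<comment> \<open>At tags in \<open>M\<close> this gauge imposes nothing; there the gauge
    \<open>\<gamma>\<close> does the work.\<close>
  define \<eta> where "\<eta> t = (if t \<in> {a..b} - M then ball t (\<delta> t) else UNIV)" for t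
  have "gauge \<eta>" unfolding gauge_def \<eta>_def using \<delta>(1) by auto
  then obtain p where p: "p tagged_division_of {a..b}" and fine: "(\<lambda>x. \<gamma> x \<inter> \<eta> x) fine p"
    using fine_division_exists_real gauge_Int[OF \<gamma>(1)] by metis
  have pp: "p tagged_partial_division_of {a..b}" and "finite p"
    using p by (auto simp: tagged_division_of_def tagged_partial_division_of_def)
  define q where "q = {xK \<in> p. fst xK \<in> M}"
  have q: "q \<subseteq> p" by (auto simp: q_def)
  have "f b - f a = (\<Sum>(x, K)\<in>p. f (Sup K) - f (Inf K))"
    using additive_tagged_division_1[OF \<open>a \<le> b\<close> p, of f] by simp
  also have "\<dots> = (\<Sum>(x, K)\<in>q. f (Sup K) - f (Inf K)) + (\<Sum>(x, K)\<in>p - q. f (Sup K) - f (Inf K))"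
    using sum.subset_diff[OF q \<open>finite p\<close>] by (simp add: add.commute)
  also have "(\<Sum>(x, K)\<in>q. f (Sup K) - f (Inf K)) \<le> (\<Sum>(x, K)\<in>q. norm (f (Sup K) - f (Inf K)))"
    by (rule sum_mono) auto
  also have "\<dots> \<le> e"
    using \<gamma>(2)[OF tagged_partial_division_subset[OF pp q]] fine q
    by (force simp: fine_def q_def)
  also have "(\<Sum>(x, K)\<in>p - q. f (Sup K) - f (Inf K)) \<le> (\<Sum>(x, K)\<in>p - q. e * (Sup K - Inf K))"
  proof (rule sum_mono, clarify)
    fix x K assume xK: "(x, K) \<in> p" "(x, K) \<notin> q"
    obtain u v where K: "K = {u..v}" "u \<le> x" "x \<le> v" "a \<le> u" "v \<le> b" "Inf K = u" "Sup K = v"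
      using tagged_partial_division_interval[OF pp xK(1)] .
    have x: "x \<in> {a..b} - M" using xK K by (auto simp: q_def)
    then have "K \<subseteq> ball x (\<delta> x)" using fine xK(1) unfolding fine_def \<eta>_def by force
    then show "f (Sup K) - f (Inf K) \<le> e * (Sup K - Inf K)" using \<delta>(2)[OF x K(2,3)] K by simp
  qed
  \<comment> \<open>Restoring the intervals of \<open>q\<close> adds only nonnegative lengths and
    lets the sum telescope to \<open>b - a\<close>.\<close>
  also have "\<dots> \<le> (\<Sum>(x, K)\<in>p. e * (Sup K - Inf K))"
  proof (rule sum_mono2[OF \<open>finite p\<close>])
    fix y assume "y \<in> p - (p - q)"
    then obtain x K where y: "y = (x, K)" "(x, K) \<in> p" by (cases y) auto
    then obtain u v where "u \<le> x" "x \<le> v" "Inf K = u" "Sup K = v"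
      using tagged_partial_division_interval[OF pp y(2)] by metis
    then show "0 \<le> (case y of (x, K) \<Rightarrow> e * (Sup K - Inf K))"
      using y(1) \<open>e > 0\<close> by simp
  qed auto
  also have "\<dots> = e * (b - a)"
    using additive_tagged_division_1[OF \<open>a \<le> b\<close> p, of "\<lambda>x. x"]
    by (simp add: case_prod_unfold flip: sum_distrib_left)
  finally have "f b - f a \<le> e * (1 + (b - a))" by (simp add: algebra_simps)
  then show "f b \<le> f a + e0" using \<open>a \<le> b\<close> by (simp add: e_def)
qed

section \<open>Gronwall's inequality with one-sided derivatives almost everywhere\<close>

text \<open>Forward difference quotients are the form in which
  \<open>integrable_ccontinuous_explicit\<close> provides convergence almost everywhere.\<close>

lemma has_right_derivative_iff_increment:
  fixes F :: "real \<Rightarrow> real"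
  shows "(F has_real_derivative D) (at t within {t..}) \<longleftrightarrow>
    (\<forall>e>0. \<exists>d>0. \<forall>h. 0 < h \<and> h < d \<longrightarrow> \<bar>(F (t + h) - F t) / h - D\<bar> < e)"
proof -
  have eq: "(F has_real_derivative D) (at t within {t..}) \<longleftrightarrow>
    ((\<lambda>y. (F y - F t) / (y - t)) \<longlongrightarrow> D) (at_right t)"
    unfolding has_field_derivative_iff at_within_Ici_at_right ..
  show ?thesis
    unfolding eq tendsto_iff eventually_at_right_field dist_real_def
  proof (intro iff_allI imp_cong refl iffI; elim exE conjE)
    fix e b assume b: "t < b" "\<forall>y>t. y < b \<longrightarrow> \<bar>(F y - F t) / (y - t) - D\<bar> < e"
    have "\<bar>(F (t + h) - F t) / h - D\<bar> < e" if "0 < h" "h < b - t" for h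
      using b(2)[rule_format, of "t + h"] that by simp
    with b(1) show "\<exists>d>0. \<forall>h. 0 < h \<and> h < d \<longrightarrow> \<bar>(F (t + h) - F t) / h - D\<bar> < e"
      by (intro exI[of _ "b - t"]) simp
  next
    fix e d :: real assume d: "d > 0" "\<forall>h. 0 < h \<and> h < d \<longrightarrow> \<bar>(F (t + h) - F t) / h - D\<bar> < e"
    then show "\<exists>b>t. \<forall>y>t. y < b \<longrightarrow> \<bar>(F y - F t) / (y - t) - D\<bar> < e"
      using d(2)[rule_format, of "y - t" for y] by (intro exI[of _ "t + d"]) auto
  qed
qed

text \<open>This is a one-sided Lebesgue differentiation theorem: off a null set the averages of the
  integrand over \<open>{t..t + k}\<close> converge to its value at \<open>t\<close>.\<close>

lemma indefinite_integral_right_derivative: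
  fixes h :: "real \<Rightarrow> real"
  assumes h: "h integrable_on {a..b}"
  obtains N where "negligible N"
    "\<And>t. t \<in> {a<..<b} - N \<Longrightarrow>
       ((\<lambda>s. integral {a..s} h) has_real_derivative h t) (at t within {t..})"
proof -
  \<comment> \<open>Extension by zero makes the integrand integrable over every box, as the
    differentiation theorem requires.\<close>
  define g where "g t = (if t \<in> {a..b} then h t else 0)" for t
  have "g integrable_on UNIV"
    using h unfolding g_def integrable_restrict_UNIV .
  then have gi: "g integrable_on cbox c d" for c d
    using integrable_on_subcbox by blast
  obtain N where N: "negligible N" "\<And>x e. \<lbrakk>x \<notin> N; 0 < e\<rbrakk> \<Longrightarrow>
      \<exists>d>0. \<forall>h. 0 < h \<and> h < d \<longrightarrow> norm(integral (cbox x (x + h *\<^sub>R One)) g /\<^sub>R h ^ DIM(real) - g x) < e"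
    using integrable_ccontinuous_explicit[OF gi] by blast
  show thesis
  proof (rule that[OF N(1)])
    fix t assume t: "t \<in> {a<..<b} - N"
    show "((\<lambda>s. integral {a..s} h) has_real_derivative h t) (at t within {t..})"
      unfolding has_right_derivative_iff_increment
    proof (intro allI impI)
      fix e :: real assume "e > 0"
      then obtain d where d: "d > 0" "\<And>k. 0 < k \<Longrightarrow> k < d \<Longrightarrow> \<bar>integral {t..t + k} g / k - g t\<bar> < e"
        using N(2)[of t e] t by (auto simp: divide_inverse mult.commute)
      have "\<bar>(integral {a..t + k} h - integral {a..t} h) / k - h t\<bar> < e"
        if k: "0 < k" "k < min d (b - t)" for k
      proof -
        have "integral {a..t} h + integral {t..t + k} h = integral {a..t + k} h"
          by (rule Henstock_Kurzweil_Integration.integral_combine)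
            (use t k integrable_on_subinterval[OF h] in auto)
        moreover have "integral {t..t + k} h = integral {t..t + k} g"
          by (rule integral_cong) (use t k in \<open>auto simp: g_def\<close>)
        moreover have "g t = h t" using t by (simp add: g_def)
        ultimately have "integral {a..t + k} h - integral {a..t} h = integral {t..t + k} g" "g t = h t"
          by auto
        then show ?thesis using d(2)[of k] k by simp
      qed
      then show "\<exists>d>0. \<forall>k. 0 < k \<and> k < d \<longrightarrow> \<bar>(integral {a..t + k} h - integral {a..t} h) / k - h t\<bar> < e"
        using d(1) t by (intro exI[of _ "min d (b - t)"]) auto
    qed
  qed
qed

text \<open>The reflection \<open>x \<mapsto> - x\<close> exchanges left and right, so the
  right-sided result applies to the reflected integrand on \<open>{-b..-a}\<close>.\<close>

lemma indefinite_integral_left_derivative: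
  fixes h :: "real \<Rightarrow> real"
  assumes h: "h integrable_on {a..b}"
  obtains N where "negligible N"
    "\<And>t. t \<in> {a<..<b} - N \<Longrightarrow>
       ((\<lambda>s. integral {a..s} h) has_real_derivative h t) (at t within {..t})"
proof -
  have "(\<lambda>x. h (- x)) integrable_on {-b..-a}" using h by (simp add: integrable_reflect_real)
  then obtain N where N: "negligible N" "\<And>t. t \<in> {-b<..<-a} - N \<Longrightarrow>
       ((\<lambda>s. integral {-b..s} (\<lambda>x. h (- x))) has_real_derivative h (- t)) (at t within {t..})"
    by (rule indefinite_integral_right_derivative) blast
  show thesis
  proof (rule that)
    show "negligible (uminus ` N)" using N(1)
      by (rule negligible_differentiable_image_negligible[rotated]) (auto intro: derivative_intros)
    fix t assume t: "t \<in> {a<..<b} - uminus ` N"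
    then have "- t \<in> {-b<..<-a} - N" by (force simp: image_iff)
    then have "((\<lambda>s. integral {-b..s} (\<lambda>x. h (- x))) has_real_derivative h t) (at (- t) within {-t..})"
      using N(2)[of "- t"] by simp
    moreover have "uminus ` {..t} = {-t..}" by auto
    ultimately have "((\<lambda>s. integral {-b..- s} (\<lambda>x. h (- x))) has_real_derivative h t * (-1)) (at t within {..t})"
      by (intro DERIV_image_chain[unfolded o_def] derivative_eq_intros) auto
    \<comment> \<open>Undoing the reflection gives the integral of \<open>h\<close> over
      \<open>{s..b}\<close>; subtracting it from the total leaves the integral over
      \<open>{a..s}\<close>.\<close>
    then have "((\<lambda>s. integral {a..b} h - integral {-b..- s} (\<lambda>x. h (- x))) has_real_derivative h t) (at t within {..t})"
      by (auto intro!: derivative_eq_intros)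
    then show "((\<lambda>s. integral {a..s} h) has_real_derivative h t) (at t within {..t})"
    proof (rule has_field_derivative_transform_within[where d = "t - a"])
      fix s assume s: "s \<in> {..t}" "dist s t < t - a"
      then have "a \<le> s" "s \<le> b" using t by (auto simp: dist_real_def)
      then have "integral {a..s} h + integral {s..b} h = integral {a..b} h"
        by (intro Henstock_Kurzweil_Integration.integral_combine h) auto
      then show "integral {a..b} h - integral {-b..- s} (\<lambda>x. h (- x)) = integral {a..s} h"
        by (simp add: integral_reflect_real)
    qed (use t in auto)
  qed
qed

section \<open>The Gronwall estimate and derivatives of absolute values\<close>

text \<open>With the integrating factor \<open>exp (- I t)\<close>, both one-sided derivatives of
  \<open>exp (- I t) * U t\<close> are nonpositive off a null set, so this product does not
  increase. \<open>U\<close> may have either sign, and the lower bound for the system applies the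
  estimate to a negated sum.\<close>

lemma gronwall_strong_lusin:
  fixes U h :: "real \<Rightarrow> real"
  assumes U: "strong_lusin_on a b U" and h: "h integrable_on {a..b}"
    and N: "negligible N" and "a \<le> b"
    and deriv: "\<And>t. t \<in> {a<..<b} - N \<Longrightarrow>
       \<exists>r l. (U has_real_derivative r) (at t within {t..}) \<and> r \<le> h t * U t \<and>
             (U has_real_derivative l) (at t within {..t}) \<and> l \<le> h t * U t"
  shows "U b \<le> exp (integral {a..b} h) * U a"
proof -
  define I where "I t = integral {a..t} h" for t
  obtain N1 where N1: "negligible N1" "\<And>t. t \<in> {a<..<b} - N1 \<Longrightarrow> (I has_real_derivative h t) (at t within {t..})"
    unfolding I_def by (rule indefinite_integral_right_derivative[OF h]) blast
  obtain N2 where N2: "negligible N2" "\<And>t. t \<in> {a<..<b} - N2 \<Longrightarrow> (I has_real_derivative h t) (at t within {..t})"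
    unfolding I_def by (rule indefinite_integral_left_derivative[OF h]) blast
  have SI: "strong_lusin_on a b I"
    unfolding I_def by (rule indefinite_integral_strong_lusin[OF h])
  have "strong_lusin_on a b (\<lambda>t. - I t)"
  proof (rule strong_lusin_on_dominated[OF SI SI, of _ 1])
    fix u v
    have "norm (- I v - - I u) = norm (I v - I u)" by (metis minus_diff_minus norm_minus_cancel)
    then show "norm (- I v - - I u) \<le> 1 * (norm (I v - I u) + norm (I v - I u))" by simp
  qed
  then have SE: "strong_lusin_on a b (\<lambda>t. exp (- I t) * U t)"
    by (intro strong_lusin_on_mult strong_lusin_on_exp U)
  have "exp (- I b) * U b \<le> exp (- I a) * U a"
  proof (rule strong_lusin_nonincreasing[OF SE])
    show "negligible (N \<union> N1 \<union> N2)" using N N1(1) N2(1) by simp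
    fix t assume t: "t \<in> {a<..<b} - (N \<union> N1 \<union> N2)"
    then obtain r l where rl: "(U has_real_derivative r) (at t within {t..})" "r \<le> h t * U t"
      "(U has_real_derivative l) (at t within {..t})" "l \<le> h t * U t"
      using deriv[of t] by auto
    have "((\<lambda>t. exp (- I t) * U t) has_real_derivative exp (- I t) * (r - h t * U t)) (at t within {t..})"
      using N1(2)[of t] t rl(1) by (auto intro!: derivative_eq_intros simp: algebra_simps)
    moreover have "((\<lambda>t. exp (- I t) * U t) has_real_derivative exp (- I t) * (l - h t * U t)) (at t within {..t})"
      using N2(2)[of t] t rl(3) by (auto intro!: derivative_eq_intros simp: algebra_simps)
    moreover have "exp (- I t) * (r - h t * U t) \<le> 0" "exp (- I t) * (l - h t * U t) \<le> 0"
      using rl by (auto intro!: mult_nonneg_nonpos)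
    ultimately show "\<exists>r l. ((\<lambda>t. exp (- I t) * U t) has_real_derivative r) (at t within {t..}) \<and> r \<le> 0 \<and>
      ((\<lambda>t. exp (- I t) * U t) has_real_derivative l) (at t within {..t}) \<and> l \<le> 0"
      by blast
  qed (rule \<open>a \<le> b\<close>)
  \<comment> \<open>\<open>I a\<close> is an integral over a single point, hence 0, and its
    exponential factor disappears.\<close>
  then have "exp (I b) * (exp (- I b) * U b) \<le> exp (I b) * U a"
    by (intro mult_left_mono) (auto simp: I_def)
  then have "U b \<le> exp (I b) * U a" by (simp add: mult.assoc[symmetric] flip: exp_add)
  then show ?thesis by (simp add: I_def)
qed

text \<open>Away from zeros of \<open>g\<close> the chain rule applies. At a zero the quotients of
  \<open>\<bar>g\<bar>\<close> are plus or minus the absolute quotients of \<open>g\<close>,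
  according to the side, so the one-sided derivatives are \<open>\<bar>D\<bar>\<close> and
  \<open>- \<bar>D\<bar>\<close>.\<close>

lemma abs_one_sided_derivatives:
  fixes g :: "real \<Rightarrow> real"
  assumes g: "(g has_real_derivative D) (at t)"
    and pos: "g t > 0 \<Longrightarrow> D \<le> s" and neg: "g t < 0 \<Longrightarrow> - D \<le> s" and zero: "g t = 0 \<Longrightarrow> \<bar>D\<bar> \<le> s"
  shows "\<exists>r l. ((\<lambda>x. \<bar>g x\<bar>) has_real_derivative r) (at t within {t..}) \<and> r \<le> s \<and>
               ((\<lambda>x. \<bar>g x\<bar>) has_real_derivative l) (at t within {..t}) \<and> l \<le> s"
proof (cases "g t = 0")
  case False
  have "((\<lambda>x. \<bar>g x\<bar>) has_real_derivative D * sgn (g t)) (at t)"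
  proof -
    have "(abs has_real_derivative sgn (g t)) (at (g t))"
      using has_derivative_norm[OF False] by (simp add: has_field_derivative_def real_norm_def[abs_def] mult_commute_abs)
    from DERIV_chain2[OF this g] show ?thesis by (simp add: mult.commute)
  qed
  moreover have "D * sgn (g t) \<le> s" using False pos neg by (cases "g t > 0") auto
  ultimately show ?thesis by (meson has_field_derivative_at_within)
next
  case True
  have "((\<lambda>y. (g y - g t) / (y - t)) \<longlongrightarrow> D) (at t)" using g by (simp add: has_field_derivative_iff)
  then have lim: "((\<lambda>y. \<bar>(g y - g t) / (y - t)\<bar>) \<longlongrightarrow> \<bar>D\<bar>) (at t)" by (rule tendsto_rabs)
  have "((\<lambda>x. \<bar>g x\<bar>) has_real_derivative \<bar>D\<bar>) (at t within {t..})"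
    unfolding has_field_derivative_iff
  proof (rule Lim_transform_within[where d = 1])
    show "((\<lambda>y. \<bar>(g y - g t) / (y - t)\<bar>) \<longlongrightarrow> \<bar>D\<bar>) (at t within {t..})"
      using lim by (rule tendsto_within_subset) auto
  qed (auto simp: True abs_divide)
  moreover have "((\<lambda>x. \<bar>g x\<bar>) has_real_derivative - \<bar>D\<bar>) (at t within {..t})"
    unfolding has_field_derivative_iff
  proof (rule Lim_transform_within[where d = 1])
    show "((\<lambda>y. - \<bar>(g y - g t) / (y - t)\<bar>) \<longlongrightarrow> - \<bar>D\<bar>) (at t within {..t})"
      using lim by (intro tendsto_minus) (rule tendsto_within_subset, auto)
  qed (auto simp: True abs_divide field_simps)
  ultimately show ?thesis using zero[OF True] by (intro exI[of _ "\<bar>D\<bar>"] exI[of _ "- \<bar>D\<bar>"]) auto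
qed

section \<open>Linear systems with essentially nonnegative matrices\<close>

lemma sum_matrix_vector_mult:
  fixes M :: "real ^ 'n ^ 'm" and v :: "real ^ 'n"
  shows "(\<Sum>i\<in>UNIV. (M *v v) $ i) = (\<Sum>j\<in>UNIV. (\<Sum>i\<in>UNIV. M $ i $ j) * v $ j)"
  unfolding matrix_vector_mult_def by (simp add: sum_distrib_right) (rule sum.swap)

lemma column_sum_le_max: "(\<Sum>i\<in>UNIV. M $ i $ j) \<le> max_column_sum M"
  for M :: "real ^ 'n::finite ^ 'n"
  unfolding max_column_sum_def by (rule Max_ge) auto

lemma min_le_column_sum: "min_column_sum M \<le> (\<Sum>i\<in>UNIV. M $ i $ j)"
  for M :: "real ^ 'n::finite ^ 'n"
  unfolding min_column_sum_def by (rule Min_le) auto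

text \<open>Replacing \<open>v $ j\<close> by its absolute value is harmless off the diagonal, where
  the entries are nonnegative. The diagonal entry may have any sign, but the assumption on the sign
  of \<open>v $ i\<close> makes its term exact.\<close>

lemma essentially_nonnegative_row_bound:
  fixes M :: "real ^ 'n ^ 'n" and v :: "real ^ 'n" and i :: 'n
  assumes M: "essentially_nonnegative M"
  defines "s \<equiv> (\<Sum>j\<in>UNIV. M $ i $ j * \<bar>v $ j\<bar>)"
  shows "v $ i \<ge> 0 \<Longrightarrow> (M *v v) $ i \<le> s" and "v $ i \<le> 0 \<Longrightarrow> - (M *v v) $ i \<le> s"
proof -
  have off: "M $ i $ j * v $ j \<le> M $ i $ j * \<bar>v $ j\<bar>" "- (M $ i $ j * v $ j) \<le> M $ i $ j * \<bar>v $ j\<bar>"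
    if "j \<noteq> i" for j
    using M that mult_left_mono[of "v $ j" "\<bar>v $ j\<bar>" "M $ i $ j"]
      mult_left_mono[of "- v $ j" "\<bar>v $ j\<bar>" "M $ i $ j"]
    unfolding essentially_nonnegative_def by auto
  show "(M *v v) $ i \<le> s" if "v $ i \<ge> 0"
    unfolding s_def matrix_vector_mult_def vec_lambda_beta
  proof (rule sum_mono)
    fix j show "M $ i $ j * v $ j \<le> M $ i $ j * \<bar>v $ j\<bar>"
      using off(1)[of j] that by (cases "j = i") auto
  qed
  show "- (M *v v) $ i \<le> s" if "v $ i \<le> 0"
    unfolding s_def matrix_vector_mult_def vec_lambda_beta sum_negf[symmetric]
  proof (rule sum_mono)
    fix j show "- (M $ i $ j * v $ j) \<le> M $ i $ j * \<bar>v $ j\<bar>"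
      using off(2)[of j] that by (cases "j = i") auto
  qed
qed

section \<open>Gronwall bounds for an essentially nonnegative system\<close>

text \<open>The model is \<open>w = D y\<close> with \<open>y\<close> the difference of the reduced
  vectors. \<open>N\<close> collects the positive times at which the equation may fail; time 0 is
  left out so that all derivatives are two-sided.\<close>

locale essentially_nonnegative_system =
  fixes H :: "real \<Rightarrow> real ^ 'n::finite ^ 'n" and w :: "real \<Rightarrow> real ^ 'n" and N :: "real set"
  assumes ess_nonneg: "\<And>t. t \<ge> 0 \<Longrightarrow> essentially_nonnegative (H t)"
    and strong_lusin: "\<And>T. T \<ge> 0 \<Longrightarrow> strong_lusin_on 0 T w"
    and negl: "negligible N"
    and deriv: "\<And>t. t > 0 \<Longrightarrow> t \<notin> N \<Longrightarrow> (w has_vector_derivative H t *v w t) (at t)"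
    and max_integrable: "\<And>T. T \<ge> 0 \<Longrightarrow> (\<lambda>t. max_column_sum (H t)) integrable_on {0..T}"
    and min_integrable: "\<And>T. T \<ge> 0 \<Longrightarrow> (\<lambda>t. min_column_sum (H t)) integrable_on {0..T}"
begin

lemma component_deriv:
  assumes "t > 0" "t \<notin> N"
  shows "((\<lambda>t. w t $ i) has_real_derivative (H t *v w t) $ i) (at t)"
  using bounded_linear.has_vector_derivative[OF bounded_linear_vec_nth deriv[OF assms]]
  by (simp add: has_real_derivative_iff_has_vector_derivative)

text \<open>The sum is a Lipschitz function of \<open>w\<close>. The coefficients allow
  \<open>b = 1\<close> for the sums in the upper bound and \<open>b = 0\<close>,
  \<open>c = 1\<close> for the negated coordinate sum in the lower bound.\<close>

lemma strong_lusin_weighted_sum: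
  assumes "T \<ge> 0"
  shows "strong_lusin_on 0 T (\<lambda>t. \<Sum>i\<in>UNIV. b * \<bar>w t $ i\<bar> - c * w t $ i)"
proof (rule strong_lusin_on_dominated[OF strong_lusin[OF assms] strong_lusin[OF assms],
      of _ "real CARD('n) * (\<bar>b\<bar> + \<bar>c\<bar>)"])
  fix u v :: real
  have "norm ((\<Sum>i\<in>UNIV. b * \<bar>w v $ i\<bar> - c * w v $ i) - (\<Sum>i\<in>UNIV. b * \<bar>w u $ i\<bar> - c * w u $ i))
      \<le> (\<Sum>i\<in>UNIV. \<bar>(b * \<bar>w v $ i\<bar> - c * w v $ i) - (b * \<bar>w u $ i\<bar> - c * w u $ i)\<bar>)"
    unfolding sum_subtractf[symmetric] real_norm_def by (rule sum_abs)
  also have "\<dots> \<le> (\<Sum>i\<in>(UNIV :: 'n set). (\<bar>b\<bar> + \<bar>c\<bar>) * norm (w v - w u))"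
  proof (rule sum_mono)
    fix i
    have "\<bar>(b * \<bar>w v $ i\<bar> - c * w v $ i) - (b * \<bar>w u $ i\<bar> - c * w u $ i)\<bar>
        = \<bar>b * (\<bar>w v $ i\<bar> - \<bar>w u $ i\<bar>) - c * (w v $ i - w u $ i)\<bar>"
      by (simp add: algebra_simps)
    also have "\<dots> \<le> \<bar>b\<bar> * \<bar>\<bar>w v $ i\<bar> - \<bar>w u $ i\<bar>\<bar> + \<bar>c\<bar> * \<bar>w v $ i - w u $ i\<bar>"
      unfolding abs_mult[symmetric] by (rule abs_triangle_ineq4)
    also have "\<dots> \<le> \<bar>b\<bar> * \<bar>w v $ i - w u $ i\<bar> + \<bar>c\<bar> * \<bar>w v $ i - w u $ i\<bar>"
      by (intro add_right_mono mult_left_mono abs_triangle_ineq3) auto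
    also have "\<dots> = (\<bar>b\<bar> + \<bar>c\<bar>) * \<bar>(w v - w u) $ i\<bar>" by (simp add: algebra_simps)
    also have "\<dots> \<le> (\<bar>b\<bar> + \<bar>c\<bar>) * norm (w v - w u)"
      by (intro mult_left_mono component_le_norm_cart) auto
    finally show "\<bar>(b * \<bar>w v $ i\<bar> - c * w v $ i) - (b * \<bar>w u $ i\<bar> - c * w u $ i)\<bar>
        \<le> (\<bar>b\<bar> + \<bar>c\<bar>) * norm (w v - w u)" .
  qed
  also have "\<dots> = real CARD('n) * (\<bar>b\<bar> + \<bar>c\<bar>) * norm (w v - w u)" by simp
  also have "\<dots> \<le> real CARD('n) * (\<bar>b\<bar> + \<bar>c\<bar>) * (norm (w v - w u) + norm (w v - w u))"
    by (intro mult_left_mono) auto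
  finally show "norm ((\<Sum>i\<in>UNIV. b * \<bar>w v $ i\<bar> - c * w v $ i) - (\<Sum>i\<in>UNIV. b * \<bar>w u $ i\<bar> - c * w u $ i))
      \<le> real CARD('n) * (\<bar>b\<bar> + \<bar>c\<bar>) * (norm (w v - w u) + norm (w v - w u))" .
qed

text \<open>\<open>c = 0\<close> gives the norm bound; \<open>c = 1\<close> (twice the sum of the negative parts) the
  preservation of nonnegativity.\<close>
lemma weighted_sum_upper_bound:
  assumes "T \<ge> 0" and c: "\<bar>c\<bar> \<le> 1"
  shows "(\<Sum>i\<in>UNIV. \<bar>w T $ i\<bar> - c * w T $ i)
    \<le> exp (integral {0..T} (\<lambda>t. max_column_sum (H t))) * (\<Sum>i\<in>UNIV. \<bar>w 0 $ i\<bar> - c * w 0 $ i)"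
proof (rule gronwall_strong_lusin[OF _ max_integrable[OF \<open>T \<ge> 0\<close>] negl \<open>T \<ge> 0\<close>])
  show "strong_lusin_on 0 T (\<lambda>t. \<Sum>i\<in>UNIV. \<bar>w t $ i\<bar> - c * w t $ i)"
    using strong_lusin_weighted_sum[OF \<open>T \<ge> 0\<close>, of 1 c] by simp
  fix t assume "t \<in> {0<..<T} - N"
  then have t: "t > 0" "t \<notin> N" by auto
  define s where "s i = (\<Sum>j\<in>UNIV. H t $ i $ j * \<bar>w t $ j\<bar>)" for i
  let ?D = "\<lambda>i. (H t *v w t) $ i"
  \<comment> \<open>At a zero of the coordinate both halves of the row bound hold, which bounds the
    absolute value of its derivative.\<close>
  have "\<exists>r l. ((\<lambda>x. \<bar>w x $ i\<bar>) has_real_derivative r) (at t within {t..}) \<and> r \<le> s i \<and>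
       ((\<lambda>x. \<bar>w x $ i\<bar>) has_real_derivative l) (at t within {..t}) \<and> l \<le> s i" for i
    using essentially_nonnegative_row_bound[OF ess_nonneg, of t "w t" i] t
    by (intro abs_one_sided_derivatives[OF component_deriv[OF t]]) (auto simp: s_def abs_le_iff)
  then obtain r l where
    r: "\<And>i. ((\<lambda>x. \<bar>w x $ i\<bar>) has_real_derivative r i) (at t within {t..})" "\<And>i. r i \<le> s i" and
    l: "\<And>i. ((\<lambda>x. \<bar>w x $ i\<bar>) has_real_derivative l i) (at t within {..t})" "\<And>i. l i \<le> s i"
    by metis
  have "(\<Sum>i\<in>UNIV. s i - c * ?D i) = (\<Sum>j\<in>UNIV. (\<Sum>i\<in>UNIV. H t $ i $ j) * (\<bar>w t $ j\<bar> - c * w t $ j))"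
  proof -
    have "(\<Sum>i\<in>UNIV. s i) = (\<Sum>j\<in>UNIV. (\<Sum>i\<in>UNIV. H t $ i $ j) * \<bar>w t $ j\<bar>)"
      unfolding s_def by (simp add: sum_distrib_right) (rule sum.swap)
    then show ?thesis
      by (simp add: sum_subtractf sum_matrix_vector_mult algebra_simps flip: sum_distrib_left)
  qed
  \<comment> \<open>Since \<open>\<bar>c\<bar> \<le> 1\<close>, the weights
    \<open>\<bar>w t $ j\<bar> - c * w t $ j\<close> are nonnegative, so each column sum may be
    replaced by the largest.\<close>
  also have "\<dots> \<le> (\<Sum>j\<in>UNIV. max_column_sum (H t) * (\<bar>w t $ j\<bar> - c * w t $ j))"
  proof (intro sum_mono mult_right_mono column_sum_le_max)
    fix j
    have "c * w t $ j \<le> \<bar>c\<bar> * \<bar>w t $ j\<bar>" by (metis abs_ge_self abs_mult)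
    also have "\<dots> \<le> 1 * \<bar>w t $ j\<bar>" by (rule mult_right_mono[OF c]) simp
    finally show "0 \<le> \<bar>w t $ j\<bar> - c * w t $ j" by simp
  qed
  finally have bound: "(\<Sum>i\<in>UNIV. s i - c * ?D i)
      \<le> max_column_sum (H t) * (\<Sum>j\<in>UNIV. \<bar>w t $ j\<bar> - c * w t $ j)"
    by (simp add: sum_distrib_left)
  have "((\<lambda>t. \<Sum>i\<in>UNIV. \<bar>w t $ i\<bar> - c * w t $ i) has_real_derivative (\<Sum>i\<in>UNIV. r i - c * ?D i)) (at t within {t..})"
    by (intro DERIV_sum DERIV_diff DERIV_cmult r has_field_derivative_at_within[OF component_deriv[OF t]])
  moreover have "((\<lambda>t. \<Sum>i\<in>UNIV. \<bar>w t $ i\<bar> - c * w t $ i) has_real_derivative (\<Sum>i\<in>UNIV. l i - c * ?D i)) (at t within {..t})"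
    by (intro DERIV_sum DERIV_diff DERIV_cmult l has_field_derivative_at_within[OF component_deriv[OF t]])
  moreover have "(\<Sum>i\<in>UNIV. r i - c * ?D i) \<le> (\<Sum>i\<in>UNIV. s i - c * ?D i)"
    "(\<Sum>i\<in>UNIV. l i - c * ?D i) \<le> (\<Sum>i\<in>UNIV. s i - c * ?D i)"
    using r(2) l(2) by (intro sum_mono diff_right_mono; simp)+
  ultimately show "\<exists>r l. ((\<lambda>t. \<Sum>i\<in>UNIV. \<bar>w t $ i\<bar> - c * w t $ i) has_real_derivative r) (at t within {t..}) \<and>
      r \<le> max_column_sum (H t) * (\<Sum>j\<in>UNIV. \<bar>w t $ j\<bar> - c * w t $ j) \<and>
      ((\<lambda>t. \<Sum>i\<in>UNIV. \<bar>w t $ i\<bar> - c * w t $ i) has_real_derivative l) (at t within {..t}) \<and>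
      l \<le> max_column_sum (H t) * (\<Sum>j\<in>UNIV. \<bar>w t $ j\<bar> - c * w t $ j)"
    using bound by (meson order_trans)
qed

lemma l1_norm_upper_bound:
  assumes "T \<ge> 0"
  shows "l1_norm (w T) \<le> exp (integral {0..T} (\<lambda>t. max_column_sum (H t))) * l1_norm (w 0)"
  using weighted_sum_upper_bound[OF assms, of 0] by (simp add: l1_norm_def)

text \<open>The sum of \<open>\<bar>w t $ i\<bar> - w t $ i\<close> is 0 initially, so the Gronwall
  bound keeps it at most 0. Its terms are nonnegative and therefore all vanish.\<close>

lemma nonneg_preserved:
  assumes "T \<ge> 0" and "\<And>i. 0 \<le> w 0 $ i"
  shows "0 \<le> w T $ i"
proof -
  have "(\<Sum>i\<in>UNIV. \<bar>w T $ i\<bar> - w T $ i) \<le> 0"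
    using weighted_sum_upper_bound[OF assms(1), of 1] assms(2) by simp
  moreover have "0 \<le> (\<Sum>i\<in>UNIV. \<bar>w T $ i\<bar> - w T $ i)" by (intro sum_nonneg) auto
  ultimately have "(\<Sum>i\<in>UNIV. \<bar>w T $ i\<bar> - w T $ i) = 0" by linarith
  then have "\<forall>i\<in>UNIV. \<bar>w T $ i\<bar> - w T $ i = 0"
    by (subst (asm) sum_nonneg_eq_0_iff) auto
  then show ?thesis by (metis UNIV_I abs_ge_zero diff_eq_eq add_0)
qed

text \<open>In the nonnegative orthant the norm is the plain coordinate sum, whose derivative
  weights the column sums by nonnegative coordinates. Negating the sum turns the lower estimate into
  one to which Gronwall's inequality applies.\<close>

lemma l1_norm_lower_bound:
  assumes "T \<ge> 0" and nonneg: "\<And>i. 0 \<le> w 0 $ i"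
  shows "l1_norm (w T) \<ge> exp (integral {0..T} (\<lambda>t. min_column_sum (H t))) * l1_norm (w 0)"
proof -
  have l1: "l1_norm (w t) = (\<Sum>i\<in>UNIV. w t $ i)" if "t \<ge> 0" for t
    unfolding l1_norm_def using nonneg_preserved[OF that nonneg] by simp
  have "- (\<Sum>i\<in>UNIV. w T $ i) \<le> exp (integral {0..T} (\<lambda>t. min_column_sum (H t))) * - (\<Sum>i\<in>UNIV. w 0 $ i)"
  proof (rule gronwall_strong_lusin[OF _ min_integrable[OF \<open>T \<ge> 0\<close>] negl \<open>T \<ge> 0\<close>])
    show "strong_lusin_on 0 T (\<lambda>t. - (\<Sum>i\<in>UNIV. w t $ i))"
      using strong_lusin_weighted_sum[OF \<open>T \<ge> 0\<close>, of 0 1] by (simp add: sum_negf)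
    fix t assume "t \<in> {0<..<T} - N"
    then have t: "t > 0" "t \<notin> N" by auto
    let ?D = "- (\<Sum>i\<in>UNIV. (H t *v w t) $ i)"
    have "((\<lambda>t. - (\<Sum>i\<in>UNIV. w t $ i)) has_real_derivative ?D) (at t)"
      by (intro DERIV_minus DERIV_sum component_deriv[OF t])
    moreover have "(\<Sum>j\<in>UNIV. min_column_sum (H t) * w t $ j) \<le> (\<Sum>i\<in>UNIV. (H t *v w t) $ i)"
      unfolding sum_matrix_vector_mult
      using nonneg_preserved[OF _ nonneg] t by (intro sum_mono mult_right_mono min_le_column_sum) auto
    then have "?D \<le> min_column_sum (H t) * - (\<Sum>i\<in>UNIV. w t $ i)"
      by (simp flip: sum_distrib_left)
    ultimately show "\<exists>r l. ((\<lambda>t. - (\<Sum>i\<in>UNIV. w t $ i)) has_real_derivative r) (at t within {t..}) \<and>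
        r \<le> min_column_sum (H t) * - (\<Sum>i\<in>UNIV. w t $ i) \<and>
        ((\<lambda>t. - (\<Sum>i\<in>UNIV. w t $ i)) has_real_derivative l) (at t within {..t}) \<and>
        l \<le> min_column_sum (H t) * - (\<Sum>i\<in>UNIV. w t $ i)"
      by (meson has_field_derivative_at_within)
  qed
  then show ?thesis using l1[of T] l1[of 0] \<open>T \<ge> 0\<close> by simp
qed

end

section \<open>Integrability of the extreme column sums\<close>

text \<open>Absolute integrability is carried because binary maxima preserve it, whereas gauge
  integrability alone need not survive them; induction extends this to finite families.\<close>

lemma absolutely_integrable_Max:
  fixes f :: "'i \<Rightarrow> real \<Rightarrow> real"
  assumes "finite A" "A \<noteq> {}" "\<And>i. i \<in> A \<Longrightarrow> f i absolutely_integrable_on S"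
  shows "(\<lambda>x. Max ((\<lambda>i. f i x) ` A)) absolutely_integrable_on S"
  using assms
proof (induction A rule: finite_ne_induct)
  case (insert i A)
  then have "(\<lambda>x. max (f i x) (Max ((\<lambda>i. f i x) ` A))) absolutely_integrable_on S"
    by (intro absolutely_integrable_max_1) auto
  then show ?case using insert by (simp add: Max_insert)
qed simp

lemma absolutely_integrable_Min:
  fixes f :: "'i \<Rightarrow> real \<Rightarrow> real"
  assumes "finite A" "A \<noteq> {}" "\<And>i. i \<in> A \<Longrightarrow> f i absolutely_integrable_on S"
  shows "(\<lambda>x. Min ((\<lambda>i. f i x) ` A)) absolutely_integrable_on S"
  using assms
proof (induction A rule: finite_ne_induct)
  case (insert i A)
  then have "(\<lambda>x. min (f i x) (Min ((\<lambda>i. f i x) ` A))) absolutely_integrable_on S"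
    by (intro absolutely_integrable_min_1) auto
  then show ?case using insert by (simp add: Min_insert)
qed simp

section \<open>The forward Kolmogorov system\<close>

lemma transposed_intensity_matrix_absolutely_integrable:
  assumes q: "transition_intensities q" and "T \<ge> 0"
  shows "(\<lambda>t. transposed_intensity_matrix q t $ i $ j) absolutely_integrable_on {0..T}"
proof -
  have off: "q i j absolutely_integrable_on {0..T}" if "i \<noteq> j" for i j
    using q that \<open>T \<ge> 0\<close> unfolding transition_intensities_def locally_integrable_def by blast
  have "(\<lambda>t. (- 1) * (\<Sum>k\<in>UNIV - {i}. q i k t)) absolutely_integrable_on {0..T}"
    using off by (intro set_integrable_mult_right absolutely_integrable_sum) auto
  then show ?thesis
    using off[of j i] by (cases "i = j") (auto simp: transposed_intensity_matrix_def)
qed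

text \<open>\<open>D\<close> and its inverse are constant in time, so each entry is a fixed finite
  linear combination of the entries of the reduced matrix.\<close>

lemma transformed_matrix_absolutely_integrable:
  assumes q: "transition_intensities q" and "T \<ge> 0"
  shows "(\<lambda>t. transformed_matrix D q t $ i $ j) absolutely_integrable_on {0..T}"
proof -
  have "(\<lambda>t. reduced_matrix q t $ k $ l) absolutely_integrable_on {0..T}" for k l
    unfolding reduced_matrix_def vec_lambda_beta
    by (intro set_integral_diff transposed_intensity_matrix_absolutely_integrable assms)
  then show ?thesis
    unfolding transformed_matrix_def matrix_matrix_mult_def vec_lambda_beta
    by (intro absolutely_integrable_sum set_integrable_mult_left set_integrable_mult_right finite) auto
qed

lemma column_sums_absolutely_integrable:
  fixes H :: "real \<Rightarrow> real ^ 'n::finite ^ 'n"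
  assumes "\<And>i j. (\<lambda>t. H t $ i $ j) absolutely_integrable_on S"
  shows "(\<lambda>t. max_column_sum (H t)) absolutely_integrable_on S"
    and "(\<lambda>t. min_column_sum (H t)) absolutely_integrable_on S"
  unfolding max_column_sum_def min_column_sum_def
  by (intro absolutely_integrable_Max absolutely_integrable_Min absolutely_integrable_sum assms; simp)+

section \<open>Conservation of probability and the reduced equation\<close>

lemma sum_option_UNIV: "(\<Sum>s\<in>UNIV. f s) = f None + (\<Sum>i\<in>UNIV. f (Some i))"
  for f :: "'n::finite option \<Rightarrow> 'a::comm_monoid_add"
  by (simp add: UNIV_option_conv sum.reindex)

text \<open>This is conservation of total probability: the diagonal entry is minus the total exit
  rate, which the other entries of the column add up to.\<close>

lemma sum_transposed_intensity_matrix_column: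
  "(\<Sum>i\<in>UNIV. transposed_intensity_matrix q t $ i $ j) = 0"
proof -
  have "(\<Sum>i\<in>UNIV. transposed_intensity_matrix q t $ i $ j)
      = transposed_intensity_matrix q t $ j $ j + (\<Sum>i\<in>UNIV - {j}. transposed_intensity_matrix q t $ i $ j)"
    by (rule sum.remove) auto
  then show ?thesis by (simp add: transposed_intensity_matrix_def)
qed

text \<open>A zero coordinate sum lets state 0 be eliminated without a constant term. This is why
  the inhomogeneity \<open>f\<close> is absent from the equation for a difference of two
  solutions.\<close>

lemma reduced_transposed_intensity_matrix:
  fixes x :: "real ^ ('n::finite option)"
  assumes "(\<Sum>s\<in>UNIV. x $ s) = 0"
  shows "reduced_vector (transposed_intensity_matrix q t *v x) = reduced_matrix q t *v reduced_vector x"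
proof -
  have None: "x $ None = - (\<Sum>j\<in>UNIV. x $ Some j)"
    using assms by (simp add: sum_option_UNIV)
  show ?thesis
    by (simp add: vec_eq_iff reduced_vector_def reduced_matrix_def matrix_vector_mult_def sum_option_UNIV
        None left_diff_distrib sum_subtractf sum_distrib_left)
qed

text \<open>A positive time is interior to \<open>{0..}\<close>, so the derivative within the
  half-line is a two-sided one there.\<close>

lemma kolmogorov_solution_deriv:
  assumes "kolmogorov_solution q p"
  obtains N where "negligible N" "\<And>t. t > 0 \<Longrightarrow> t \<notin> N \<Longrightarrow>
    (p has_vector_derivative transposed_intensity_matrix q t *v p t) (at t)"
proof -
  have "AE t in lebesgue. t \<ge> 0 \<longrightarrow>
        (p has_vector_derivative transposed_intensity_matrix q t *v p t) (at t within {0..})"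
    using assms unfolding kolmogorov_solution_def by blast
  then obtain N where "N \<in> null_sets lebesgue" and N: "\<And>t. t \<notin> N \<Longrightarrow> t \<ge> 0 \<Longrightarrow>
        (p has_vector_derivative transposed_intensity_matrix q t *v p t) (at t within {0..})"
    unfolding eventually_ae_filter by (auto simp: subset_iff)
  show thesis
  proof (rule that)
    show "negligible N" using \<open>N \<in> null_sets lebesgue\<close> by (simp add: negligible_iff_null_sets)
    fix t :: real assume t: "t > 0" "t \<notin> N"
    then have "(p has_vector_derivative transposed_intensity_matrix q t *v p t) (at t within {0..})"
      using N by simp
    moreover have "t \<in> interior {0..}" using t(1) interior_real_atLeast[of 0] by simp
    then have "at t within {0..} = at t" by (rule at_within_interior)
    ultimately show "(p has_vector_derivative transposed_intensity_matrix q t *v p t) (at t)" by simp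
  qed
qed

lemma kolmogorov_solution_strong_lusin:
  assumes "kolmogorov_solution q p" "T \<ge> 0"
  shows "strong_lusin_on 0 T p"
  using assms abs_continuous_imp_strong_lusin
  unfolding kolmogorov_solution_def locally_abs_continuous_def by blast

text \<open>This serves two images of the difference of the solutions: its coordinate sum and its
  transform by \<open>D\<close> after reduction.\<close>

lemma bounded_linear_strong_lusin_diff:
  assumes L: "bounded_linear L" and f: "strong_lusin_on a b f" and g: "strong_lusin_on a b g"
  shows "strong_lusin_on a b (\<lambda>t. L (f t - g t))"
proof -
  interpret bounded_linear L by (rule L)
  obtain K where K: "K > 0" "\<And>x. norm (L x) \<le> norm x * K" using pos_bounded by blast
  show ?thesis
  proof (rule strong_lusin_on_dominated[OF f g, of _ K])
    fix u v
    have "(f v - g v) - (f u - g u) = (f v - f u) - (g v - g u)" by simp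
    then have "norm (L (f v - g v) - L (f u - g u)) = norm (L ((f v - f u) - (g v - g u)))"
      by (metis diff)
    also have "\<dots> \<le> norm ((f v - f u) - (g v - g u)) * K" by (rule K)
    also have "\<dots> \<le> (norm (f v - f u) + norm (g v - g u)) * K"
      using K(1) by (intro mult_right_mono norm_triangle_ineq4) auto
    finally show "norm (L (f v - g v) - L (f u - g u)) \<le> K * (norm (f v - f u) + norm (g v - g u))"
      by (simp add: mult.commute)
  qed
qed

section \<open>The two-sided bound for a pair of solutions\<close>

theorem theorem1:
  fixes q :: "'n::finite option \<Rightarrow> 'n option \<Rightarrow> real \<Rightarrow> real"
    and D :: "real ^ 'n ^ 'n"
    and d :: real
    and p1 p2 :: "real \<Rightarrow> real ^ ('n option)"
  assumes intensities: "transition_intensities q"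
    and D_nonneg: "\<And>i j. 0 \<le> D $ i $ j"
    and d_pos: "d > 0"
    and D_bound: "\<And>z. norm_1D D z \<ge> d * l1_norm z"
    and H_ess_nonneg: "\<And>t. t \<ge> 0 \<Longrightarrow> essentially_nonnegative (transformed_matrix D q t)"
    and sol1: "kolmogorov_solution q p1" and init1: "probability_vector (p1 0)"
    and sol2: "kolmogorov_solution q p2" and init2: "probability_vector (p2 0)"
  shows "(\<forall>t\<ge>0.
            norm_1D D (reduced_vector (p1 t) - reduced_vector (p2 t))
            \<le> exp (integral {0..t} (\<lambda>\<tau>. max_column_sum (transformed_matrix D q \<tau>)))
               * norm_1D D (reduced_vector (p1 0) - reduced_vector (p2 0)))
       \<and> ((\<forall>i. 0 \<le> (D *v (reduced_vector (p1 0) - reduced_vector (p2 0))) $ i) \<longrightarrow>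
          (\<forall>t\<ge>0.
            norm_1D D (reduced_vector (p1 t) - reduced_vector (p2 t))
            \<ge> exp (integral {0..t} (\<lambda>\<tau>. min_column_sum (transformed_matrix D q \<tau>)))
               * norm_1D D (reduced_vector (p1 0) - reduced_vector (p2 0))))"
proof -
  \<comment> \<open>The lower bound on \<open>norm_1D\<close> forces the kernel of \<open>D\<close>
    to be trivial, and a square matrix with trivial kernel is invertible.\<close>
  have inv: "matrix_inv D ** D = mat 1"
  proof -
    have "x = 0" if "D *v x = 0" for x
    proof -
      have "d * l1_norm x \<le> 0" using D_bound[of x] that by (simp add: norm_1D_def l1_norm_def)
      then have "l1_norm x \<le> 0" using d_pos by (simp add: mult_le_0_iff)
      moreover have "\<bar>x $ i\<bar> \<le> l1_norm x" for i
        unfolding l1_norm_def by (rule member_le_sum) auto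
      ultimately show ?thesis by (simp add: vec_eq_iff) (meson abs_le_zero_iff order_trans)
    qed
    then have "invertible D"
      unfolding invertible_left_inverse matrix_left_invertible_ker by blast
    \<comment> \<open>\<open>matrix_inv\<close> is defined by choice, so existence of an inverse is
      what gives access to its property.\<close>
    then show ?thesis
      unfolding invertible_def matrix_inv_def by (rule someI2_ex) simp
  qed
  define A where "A = transposed_intensity_matrix q"
  define H where "H = transformed_matrix D q"
  obtain N1 where N1: "negligible N1" "\<And>t. t > 0 \<Longrightarrow> t \<notin> N1 \<Longrightarrow> (p1 has_vector_derivative A t *v p1 t) (at t)"
    unfolding A_def by (rule kolmogorov_solution_deriv[OF sol1]) blast
  obtain N2 where N2: "negligible N2" "\<And>t. t > 0 \<Longrightarrow> t \<notin> N2 \<Longrightarrow> (p2 has_vector_derivative A t *v p2 t) (at t)"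
    unfolding A_def by (rule kolmogorov_solution_deriv[OF sol2]) blast
  define N where "N = N1 \<union> N2"
  have N: "negligible N" using N1(1) N2(1) by (simp add: N_def)
  define x where "x t = p1 t - p2 t" for t
  have x_deriv: "(x has_vector_derivative A t *v x t) (at t)" if "t > 0" "t \<notin> N" for t
    using has_vector_derivative_diff[OF N1(2)[of t] N2(2)[of t]] that
    by (simp add: x_def[abs_def] N_def matrix_vector_mult_diff_distrib)
  have x_image: "strong_lusin_on 0 T (\<lambda>t. L (x t))" if "T \<ge> 0" "bounded_linear L"
    for T and L :: "real ^ ('n option) \<Rightarrow> 'z::real_normed_vector"
    unfolding x_def
    by (intro bounded_linear_strong_lusin_diff kolmogorov_solution_strong_lusin[OF sol1]
        kolmogorov_solution_strong_lusin[OF sol2] that)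
  have bl_sum: "bounded_linear (\<lambda>v :: real ^ ('n option). c * (\<Sum>s\<in>UNIV. v $ s))" for c
    by (intro bounded_linear_const_mult bounded_linear_sum bounded_linear_vec_nth)
  \<comment> \<open>The coordinate sum has derivative 0 almost everywhere. Taking
    \<open>c = 1\<close> and \<open>c = - 1\<close> in the monotonicity lemma shows that it is
    constant.\<close>
  have "c * (\<Sum>s\<in>UNIV. x T $ s) \<le> c * (\<Sum>s\<in>UNIV. x 0 $ s)" if "T \<ge> 0" for c T
  proof (rule strong_lusin_nonincreasing[OF x_image[OF that bl_sum] N that])
    fix t assume "t \<in> {0<..<T} - N"
    then have "((\<lambda>t. c * (\<Sum>s\<in>UNIV. x t $ s)) has_vector_derivative c * (\<Sum>s\<in>UNIV. (A t *v x t) $ s)) (at t)"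
      by (intro bounded_linear.has_vector_derivative[OF bl_sum x_deriv]) auto
    then have "((\<lambda>t. c * (\<Sum>s\<in>UNIV. x t $ s)) has_real_derivative 0) (at t)"
      by (simp add: has_real_derivative_iff_has_vector_derivative sum_matrix_vector_mult A_def
          sum_transposed_intensity_matrix_column)
    then show "\<exists>r l. ((\<lambda>t. c * (\<Sum>s\<in>UNIV. x t $ s)) has_real_derivative r) (at t within {t..}) \<and> r \<le> 0 \<and>
        ((\<lambda>t. c * (\<Sum>s\<in>UNIV. x t $ s)) has_real_derivative l) (at t within {..t}) \<and> l \<le> 0"
      by (meson has_field_derivative_at_within order_refl)
  qed
  from this[of _ 1] this[of _ "- 1"]
  have "(\<Sum>s\<in>UNIV. x t $ s) = (\<Sum>s\<in>UNIV. x 0 $ s)" if "t \<ge> 0" for t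
    using that by (auto intro: antisym)
  \<comment> \<open>Both initial vectors have total mass 1, so the constant is 0.\<close>
  then have sum_x: "(\<Sum>s\<in>UNIV. x t $ s) = 0" if "t \<ge> 0" for t
    using that init1 init2 by (simp add: x_def sum_subtractf probability_vector_def)
  define w where "w t = D *v reduced_vector (x t)" for t
  have bl_w: "bounded_linear (\<lambda>v. D *v reduced_vector v)"
    by (intro bounded_linear_compose[OF matrix_vector_mul_bounded_linear])
      (auto intro!: linear_conv_bounded_linear[THEN iffD1] linearI simp: reduced_vector_def vec_eq_iff)
  have w_deriv: "(w has_vector_derivative H t *v w t) (at t)" if "t > 0" "t \<notin> N" for t
  proof -
    have "D *v reduced_vector (A t *v x t) = D *v (reduced_matrix q t *v reduced_vector (x t))"
      unfolding A_def using that(1) by (subst reduced_transposed_intensity_matrix[OF sum_x]) auto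
    \<comment> \<open>The product \<open>matrix_inv D ** D\<close> inside \<open>H t *v w t\<close>
      cancels.\<close>
    also have "\<dots> = H t *v w t"
      unfolding H_def w_def transformed_matrix_def
      by (simp add: matrix_vector_mul_assoc matrix_mul_assoc[symmetric] inv)
    finally show ?thesis
      using bounded_linear.has_vector_derivative[OF bl_w x_deriv[OF that]] by (simp add: w_def[abs_def])
  qed
  interpret essentially_nonnegative_system H w N
  proof
    show "essentially_nonnegative (H t)" if "t \<ge> 0" for t using H_ess_nonneg[OF that] by (simp add: H_def)
    show "strong_lusin_on 0 T w" if "T \<ge> 0" for T
      unfolding w_def[abs_def] using x_image[OF that bl_w] .
    show "(\<lambda>t. max_column_sum (H t)) integrable_on {0..T}"
      "(\<lambda>t. min_column_sum (H t)) integrable_on {0..T}" if "T \<ge> 0" for T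
      unfolding H_def
      by (intro set_lebesgue_integral_eq_integral(1) column_sums_absolutely_integrable
          transformed_matrix_absolutely_integrable intensities that)+
  qed (use N w_deriv in auto)
  have w: "D *v (reduced_vector (p1 t) - reduced_vector (p2 t)) = w t" for t
    unfolding w_def x_def by (rule arg_cong[where f = "(*v) D"]) (simp add: reduced_vector_def vec_eq_iff)
  show ?thesis
    unfolding norm_1D_def w H_def[symmetric]
    using l1_norm_upper_bound l1_norm_lower_bound unfolding H_def by blast
qed

end
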